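(* Let $n\ge 1$ and let $\mathcal{O}_{j_{\mathrm{Sp}}(I)}=\{S(-\mathbb{J})S^{-1} : S\in\mathrm{Sp}(2n,\mathbb{R})\}\subset\mathfrak{sp}(2n,\mathbb{R})$ be the adjoint orbit of $\mathrm{Sp}(2n,\mathbb{R})$ through $j_{\mathrm{Sp}}(I)=-\mathbb{J}$. Then $\mathcal{O}_{j_{\mathrm{Sp}}(I)}$ is precisely the set $\mathcal{J}(\mathbb{R}^{2n},\omega_{\mathbb{R}^{2n}})$ of $\omega_{\mathbb{R}^{2n}}$-compatible complex structures on $\mathbb{R}^{2n}$.
   Context: $\mathbb{J}=\begin{bmatrix}0_n & I_n\\ -I_n & 0_n\end{bmatrix}$ and $\omega_{\mathbb{R}^{2n}}(v,w)=v^\top\mathbb{J}w$ on $\mathbb{R}^{2n}$. $\mathrm{Sp}(2n,\mathbb{R})=\{S : S^\top\mathbb{J}S=\mathbb{J}\}$, with Lie algebra $\mathfrak{sp}(2n,\mathbb{R})=\{\zeta : \zeta^\top\mathbb{J}+\mathbb{J}\zeta=0\}$. The map $j_{\mathrm{Sp}}$ is $j_{\mathrm{Sp}}(E)=-EE^\top\mathbb{J}$. A complex structure on $\mathbb{R}^{2n}$ is an $\mathbb{R}$-linear map $j:\mathbb{R}^{2n}\to\mathbb{R}^{2n}$ with $j^2=-I$. It is called $\omega_{\mathbb{R}^{2n}}$-compatible if (i) $j\in\mathrm{Sp}(2n,\mathbb{R})$, and (ii) the bilinear form $g_j(u,v):=\omega_{\mathbb{R}^{2n}}(u,jv)$ is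 positive-definite. Linear maps of $\mathbb{R}^{2n}$ are identified with their matrices in the standard basis. *)

theory Defs
  imports "HOL-Analysis.Analysis"
begin

text \<open>
  The space of dimension \<open>2n\<close> is \<open>real ^ ('n + 'n)\<close> with \<open>n = CARD('n)\<close>; the standard basis vectors
  indexed by \<open>Inl\<close> are the first \<open>n\<close>, those indexed by \<open>Inr\<close> the last \<open>n\<close>.  Types being
  nonempty, \<open>n \<ge> 1\<close> holds automatically.
\<close>

definition block_matrix ::
  "real^'n^'n \<Rightarrow> real^'n^'n \<Rightarrow> real^'n^'n \<Rightarrow> real^'n^'n \<Rightarrow> real^('n + 'n)^('n + 'n)" where
  "block_matrix A B C D =
     (\<chi> i k. case i of
        Inl a \<Rightarrow> (case k of Inl b \<Rightarrow> A $ a $ b | Inr b \<Rightarrow> B $ a $ b)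
      | Inr a \<Rightarrow> (case k of Inl b \<Rightarrow> C $ a $ b | Inr b \<Rightarrow> D $ a $ b))"

definition J_std :: "real^('n::finite + 'n)^('n + 'n)" where
  "J_std = block_matrix 0 (mat 1) (- mat 1) 0"

definition omega_std :: "real^('n::finite + 'n) \<Rightarrow> real^('n + 'n) \<Rightarrow> real" where
  "omega_std v w = v \<bullet> (J_std *v w)"

definition Sp :: "(real^('n::finite + 'n)^('n + 'n)) set" where
  "Sp = {S. transpose S ** J_std ** S = J_std}"

definition sp_algebra :: "(real^('n::finite + 'n)^('n + 'n)) set" where
  "sp_algebra = {Z. transpose Z ** J_std + J_std ** Z = 0}"

definition j_Sp :: "real^('n::finite + 'n)^('n + 'n) \<Rightarrow> real^('n + 'n)^('n + 'n)" where
  "j_Sp E = - (E ** transpose E ** J_std)"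

definition adjoint_orbit ::
  "real^('n::finite + 'n)^('n + 'n) \<Rightarrow> (real^('n + 'n)^('n + 'n)) set" where
  "adjoint_orbit Z = {S ** Z ** matrix_inv S | S. S \<in> Sp}"

definition complex_structure ::
  "(real^('n::finite + 'n) \<Rightarrow> real^('n + 'n)) \<Rightarrow> bool" where
  "complex_structure j \<longleftrightarrow> linear j \<and> (\<forall>v. j (j v) = - v)"

text \<open>
  Symmetry is not part of positive-definiteness here; for the form \<open>u, v \<mapsto> omega_std u (j v)\<close> it
  follows from \<open>j\<close> being a symplectic complex structure.
\<close>

definition positive_definite :: "('a::real_vector \<Rightarrow> 'a \<Rightarrow> real) \<Rightarrow> bool" where
  "positive_definite g \<longleftrightarrow> (\<forall>v. v \<noteq> 0 \<longrightarrow> g v v > 0)"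

definition compatible_complex_structures ::
  "(real^('n::finite + 'n) \<Rightarrow> real^('n + 'n)) set" where
  "compatible_complex_structures =
     {j. complex_structure j \<and> matrix j \<in> Sp \<and> positive_definite (\<lambda>u v. omega_std u (j v))}"

end

theory Submission
  imports Defs
begin

text \<open>
  If \<open>S\<close> is symplectic then \<open>S\<^sup>-\<^sup>1 = - J S\<^sup>T J\<close>, so \<open>S (- J) S\<^sup>-\<^sup>1 = - S S\<^sup>T J\<close> and the associated form is
  \<open>v \<mapsto> \<parallel>S\<^sup>T J v\<parallel>\<^sup>2\<close>.  Conversely, for a compatible \<open>j\<close> one builds, one vector at a time, an
  isotropic family \<open>e\<close> of \<open>n\<close> vectors orthonormal for \<open>g\<^sub>j\<close>; the matrix \<open>S\<close> with columns
  \<open>e\<^sub>a\<close> and \<open>j e\<^sub>a\<close> is symplectic and satisfies \<open>j S = S (- J)\<close>.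
\<close>

section \<open>Signs in matrix products and transposes\<close>

lemma matrix_mult_minus_left: "(- A) ** B = - (A ** B)"
  for A :: "'a::ring_1^'n^'m" and B :: "'a^'p^'n"
  by (simp add: matrix_matrix_mult_def vec_eq_iff sum_negf)

lemma matrix_mult_minus_right: "A ** (- B) = - (A ** B)"
  for A :: "'a::ring_1^'n^'m" and B :: "'a^'p^'n"
  by (simp add: matrix_matrix_mult_def vec_eq_iff sum_negf)

lemma transpose_uminus: "transpose (- A) = - transpose A"
  for A :: "'a::ring_1^'n^'m"
  by (simp add: transpose_def vec_eq_iff)

lemma matrix_vector_mult_uminus_left: "(- A) *v x = - (A *v x)"
  for A :: "'a::ring_1^'n^'m"
  by (simp add: matrix_vector_mult_def vec_eq_iff sum_negf)

lemma matrix_vector_mult_uminus_right: "A *v (- x) = - (A *v x)"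
  for A :: "'a::ring_1^'n^'m"
  by (simp add: matrix_vector_mult_def vec_eq_iff sum_negf)

lemma inner_matrix_vector_mult: "v \<bullet> (A *v w) = (transpose A *v v) \<bullet> w"
  for A :: "real^'n^'m"
  by (simp add: dot_lmul_matrix)

section \<open>The standard symplectic matrix\<close>

lemma J_std_nth:
  "J_std $ Inl a $ Inl b = 0" "J_std $ Inl a $ Inr b = (if a = b then 1 else 0)"
  "J_std $ Inr a $ Inl b = (if a = b then - 1 else 0)" "J_std $ Inr a $ Inr b = 0"
  by (simp_all add: J_std_def block_matrix_def mat_def)

lemma transpose_J_std: "transpose (J_std :: real^('n::finite + 'n)^('n + 'n)) = - J_std"
proof -
  have "J_std $ k $ i = - (J_std :: real^('n + 'n)^('n + 'n)) $ i $ k" for i k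
    by (cases i; cases k) (simp_all add: J_std_nth)
  then show ?thesis unfolding vec_eq_iff transpose_def vec_lambda_beta vector_uminus_component by blast
qed

lemma UNIV_sum_split: "sum f (UNIV :: ('a::finite + 'b::finite) set)
    = (\<Sum>a\<in>UNIV. f (Inl a)) + (\<Sum>b\<in>UNIV. f (Inr b))"
  using sum.Plus[of "UNIV :: 'a set" "UNIV :: 'b set" f] by (simp add: comp_def)

lemma J_std_square: "J_std ** J_std = - (mat 1 :: real^('n::finite + 'n)^('n + 'n))"
proof -
  have "(J_std ** J_std) $ i $ k = - (mat 1 :: real^('n + 'n)^('n + 'n)) $ i $ k" for i k
    by (cases i; cases k)
      (simp_all add: matrix_matrix_mult_def UNIV_sum_split J_std_nth mat_def if_distrib
        if_distribR cong: if_cong)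
  then show ?thesis by (simp add: vec_eq_iff)
qed

lemma J_std_square_mult: "J_std ** (J_std ** A) = - (A :: real^'m^('n::finite + 'n))"
  by (simp add: matrix_mul_assoc J_std_square matrix_mult_minus_left)

section \<open>The symplectic group and its inverses\<close>

lemma J_std_in_Sp: "J_std \<in> Sp"
  by (simp add: Sp_def transpose_J_std J_std_square matrix_mult_minus_left)

lemma uminus_in_Sp: "S \<in> Sp \<Longrightarrow> - S \<in> Sp"
  by (simp add: Sp_def transpose_uminus matrix_mult_minus_left matrix_mult_minus_right)

text \<open>Multiply the defining equation of \<open>Sp\<close> on the left by
  \<open>- J_std\<close> and use that \<open>J_std\<close> squares to
  \<open>- mat 1\<close>.\<close>

lemma Sp_left_inverse:
  assumes "S \<in> Sp"
  shows "- (J_std ** transpose S ** J_std) ** S = mat 1"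
proof -
  have "transpose S ** (J_std ** S) = J_std"
    using assms by (simp add: Sp_def matrix_mul_assoc)
  then show ?thesis
    by (simp add: matrix_mult_minus_left J_std_square flip: matrix_mul_assoc)
qed

lemma Sp_right_inverse:
  assumes "S \<in> Sp"
  shows "S ** - (J_std ** transpose S ** J_std) = mat 1"
  using Sp_left_inverse[OF assms] matrix_left_right_inverse by blast

lemma Sp_invertible: "S \<in> Sp \<Longrightarrow> invertible S"
  unfolding invertible_def using Sp_left_inverse Sp_right_inverse by blast

lemma Sp_matrix_inv_mult:
  assumes "S \<in> Sp"
  shows "S ** matrix_inv S = mat 1" "matrix_inv S ** S = mat 1"
proof -
  have "\<exists>T. S ** T = mat 1 \<and> T ** S = mat 1"
    using Sp_invertible[OF assms] by (simp add: invertible_def)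
  then have "S ** matrix_inv S = mat 1 \<and> matrix_inv S ** S = mat 1"
    unfolding matrix_inv_def by (rule someI_ex)
  then show "S ** matrix_inv S = mat 1" "matrix_inv S ** S = mat 1" by auto
qed

lemma Sp_matrix_inv:
  assumes "S \<in> Sp"
  shows "matrix_inv S = - (J_std ** transpose S ** J_std)"
proof -
  have "matrix_inv S = matrix_inv S ** (S ** - (J_std ** transpose S ** J_std))"
    by (simp add: Sp_right_inverse[OF assms])
  also have "\<dots> = matrix_inv S ** S ** - (J_std ** transpose S ** J_std)"
    by (rule matrix_mul_assoc)
  also have "\<dots> = - (J_std ** transpose S ** J_std)"
    by (simp add: Sp_matrix_inv_mult(2)[OF assms])
  finally show ?thesis .
qed

lemma Sp_mult:
  assumes "S \<in> Sp" "T \<in> Sp"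
  shows "S ** T \<in> Sp"
proof -
  have "transpose (S ** T) ** J_std ** (S ** T)
      = transpose T ** (transpose S ** J_std ** S) ** T"
    by (simp add: matrix_transpose_mul matrix_mul_assoc)
  then show ?thesis using assms by (simp add: Sp_def)
qed

text \<open>The left inverse of a square matrix is also a right inverse; cancelling the trailing
  \<open>J_std\<close> in that identity leaves
  \<open>S ** J_std ** transpose S = J_std\<close>.\<close>

lemma Sp_transpose:
  assumes "S \<in> Sp"
  shows "transpose S \<in> Sp"
proof -
  have "S ** (J_std ** transpose S ** J_std) = - mat 1"
    using Sp_right_inverse[OF assms] by (simp add: matrix_mult_minus_right minus_equation_iff)
  then have "S ** (J_std ** transpose S ** J_std) ** J_std = - mat 1 ** J_std"
    by simp
  then have "S ** (J_std ** (transpose S ** (J_std ** J_std))) = - J_std"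
    by (simp add: matrix_mult_minus_left flip: matrix_mul_assoc)
  then have "S ** J_std ** transpose S = J_std"
    by (simp add: J_std_square matrix_mult_minus_right matrix_mul_assoc)
  then show ?thesis by (simp add: Sp_def)
qed

text \<open>With the explicit inverse, two factors \<open>J_std\<close> cancel up to sign. The
  result is \<open>j_Sp S\<close>, so the orbit through \<open>- J_std\<close> is the image of
  \<open>Sp\<close> under \<open>j_Sp\<close>.\<close>

lemma conjugate_uminus_J_std:
  assumes "S \<in> Sp"
  shows "S ** - J_std ** matrix_inv S = - (S ** transpose S ** J_std)"
  by (simp add: Sp_matrix_inv[OF assms] matrix_mult_minus_left matrix_mult_minus_right
      J_std_square_mult flip: matrix_mul_assoc)

text \<open>Moving \<open>J_std\<close> and \<open>S\<close> to the other side of the inner product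
  costs one sign, since \<open>J_std\<close> is skew. This gives positivity on the orbit.\<close>

lemma omega_std_conjugate:
  "omega_std v ((- (S ** transpose S ** J_std)) *v v) = (norm (transpose S *v (J_std *v v)))\<^sup>2"
proof -
  have "omega_std v ((- (S ** transpose S ** J_std)) *v v)
      = - (v \<bullet> (J_std *v (S *v (transpose S *v (J_std *v v)))))"
    unfolding omega_std_def matrix_vector_mult_uminus_left matrix_vector_mult_uminus_right
    by (simp add: matrix_vector_mul_assoc matrix_mul_assoc del: transpose_matrix_vector)
  also have "\<dots> = (transpose S *v (J_std *v v)) \<bullet> (transpose S *v (J_std *v v))"
    by (simp add: inner_matrix_vector_mult transpose_J_std matrix_vector_mult_uminus_left
        matrix_vector_mult_uminus_right del: transpose_matrix_vector)
  finally show ?thesis by (simp add: power2_norm_eq_inner)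
qed

section \<open>The symplectic form\<close>

lemma omega_std_commute: "omega_std v w = - omega_std w v"
proof -
  have "omega_std v w = (transpose J_std *v v) \<bullet> w"
    unfolding omega_std_def by (rule inner_matrix_vector_mult)
  then show ?thesis
    by (simp add: transpose_J_std matrix_vector_mult_uminus_left omega_std_def inner_commute)
qed

lemma omega_std_Sp:
  assumes "S \<in> Sp"
  shows "omega_std (S *v v) (S *v w) = omega_std v w"
proof -
  have "omega_std (S *v v) (S *v w) = v \<bullet> (transpose S ** J_std ** S *v w)"
    using dot_lmul_matrix[of v "transpose S" "J_std *v (S *v w)"]
    by (simp add: omega_std_def matrix_vector_mul_assoc matrix_mul_assoc)
  then show ?thesis using assms by (simp add: Sp_def omega_std_def)
qed

text \<open>Turns membership in \<open>Sp\<close> into a condition on columns: they must form a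
  symplectic basis.\<close>

lemma transpose_J_std_mult_nth:
  "(transpose S ** J_std ** S) $ i $ k = omega_std (column i S) (column k S)"
proof -
  have "(transpose S ** J_std ** S) $ i $ k
      = axis i 1 \<bullet> ((transpose S ** J_std ** S) *v axis k 1)"
    by (simp add: inner_axis' matrix_vector_mult_basis column_def)
  also have "\<dots> = omega_std (S *v axis i 1) (S *v axis k 1)"
    using dot_lmul_matrix[of "axis i 1" "transpose S" "J_std *v (S *v axis k 1)"]
    by (simp add: omega_std_def matrix_vector_mul_assoc matrix_mul_assoc)
  finally show ?thesis by (simp add: matrix_vector_mult_basis)
qed

section \<open>Bases adapted to a compatible structure\<close>

text \<open>Induction on \<open>A\<close>: a dimension count yields a nonzero vector that is
  \<open>omega_std\<close>-orthogonal to every \<open>e a\<close> and \<open>M *v e a\<close>, and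
  rescaling makes it the next member.\<close>

lemma isotropic_orthonormal_family:
  fixes M :: "real^('n::finite + 'n)^('n + 'n)"
  assumes M: "M \<in> Sp" "M ** M = - mat 1"
    and pos: "\<And>v. v \<noteq> 0 \<Longrightarrow> omega_std v (M *v v) > 0"
    and fin: "finite A"
  shows "\<exists>e. \<forall>a\<in>A. \<forall>b\<in>A. omega_std (e a) (e b) = 0 \<and>
           omega_std (e a) (M *v e b) = (if (a::'n) = b then 1 else 0)"
  using fin
proof (induction A)
  case empty
  then show ?case by simp
next
  case (insert x A)
  then obtain e where e: "\<And>a b. a \<in> A \<Longrightarrow> b \<in> A \<Longrightarrow> omega_std (e a) (e b) = 0"
      "\<And>a b. a \<in> A \<Longrightarrow> b \<in> A \<Longrightarrow> omega_std (e a) (M *v e b) = (if a = b then 1 else 0)"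
    by blast
  \<comment> \<open>Applying \<open>M\<close> to both arguments preserves the form, and
    \<open>M ** M = - mat 1\<close> turns the result into the swapped expression.\<close>
  have sym: "omega_std u (M *v v) = omega_std v (M *v u)" for u v
  proof -
    have "omega_std u (M *v v) = omega_std (M *v u) (M *v (M *v v))"
      by (simp add: omega_std_Sp[OF M(1)])
    also have "\<dots> = - omega_std (M *v u) v"
      by (simp add: matrix_vector_mul_assoc M(2) matrix_vector_mult_uminus_left omega_std_def
          matrix_vector_mult_uminus_right)
    also have "\<dots> = omega_std v (M *v u)"
      by (metis omega_std_commute add.inverse_inverse)
    finally show ?thesis .
  qed
  \<comment> \<open>Euclidean orthogonality to \<open>J_std *v y\<close> means
    \<open>omega_std u y = 0\<close>, so the complement of \<open>V\<close> consists of the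
    admissible new vectors.\<close>
  define V where "V = (\<lambda>a. J_std *v e a) ` A \<union> (\<lambda>a. J_std *v (M *v e a)) ` A"
  \<comment> \<open>The index \<open>x\<close> lies outside \<open>A\<close>; hence \<open>V\<close>
    has fewer than \<open>2n\<close> elements and cannot span the space.\<close>
  have "card A < CARD('n)"
    using insert by (metis finite_code card_seteq UNIV_I linorder_not_less subset_UNIV)
  have "dim V \<le> card V"
    using insert by (intro dim_le_card') (simp add: V_def)
  also have "\<dots> \<le> card A + card A"
    unfolding V_def using insert(1)
    by (intro order.trans[OF card_Un_le] add_mono card_image_le)
  also have "\<dots> < DIM(real^('n + 'n))"
    using \<open>card A < CARD('n)\<close> by simp
  finally obtain u where u: "u \<noteq> 0" "\<And>y. y \<in> span V \<Longrightarrow> orthogonal u y"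
    using orthogonal_to_subspace_exists by metis
  \<comment> \<open>\<open>c\<close> is the length of \<open>u\<close> for the form induced by
    \<open>M\<close>, so \<open>w\<close> has length one.\<close>
  define c where "c = sqrt (omega_std u (M *v u))"
  define w where "w = (1 / c) *\<^sub>R u"
  have c: "c > 0" "c * c = omega_std u (M *v u)"
    using pos[OF u(1)] by (simp_all add: c_def)
  have "orthogonal u (J_std *v e a)" "orthogonal u (J_std *v (M *v e a))" if "a \<in> A" for a
    using that by (auto intro!: u(2) span_base simp: V_def)
  then have w: "omega_std w (e a) = 0" "omega_std w (M *v e a) = 0" if "a \<in> A" for a
    using that by (simp_all add: w_def omega_std_def orthogonal_def)
  then have w': "omega_std (e a) w = 0" "omega_std (e a) (M *v w) = 0" if "a \<in> A" for a
    using that sym[of "e a" w] omega_std_commute[of "e a" w] by simp_all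
  have ww: "omega_std w w = 0"
    using omega_std_commute[of w w] by linarith
  have "omega_std w (M *v w) = 1 / (c * c) * omega_std u (M *v u)"
    by (simp add: w_def omega_std_def matrix_vector_mult_scaleR)
  then have gww: "omega_std w (M *v w) = 1"
    using c(2) pos[OF u(1)] by simp
  show ?case
    by (rule exI[of _ "e(x := w)"]) (use e w w' ww gww insert(2) in \<open>auto split: if_splits\<close>)
qed

text \<open>\<open>M\<close> sends \<open>e a\<close> to \<open>M *v e a\<close> and that vector to
  \<open>- e a\<close>, just as \<open>- J_std\<close> acts on the standard basis; hence the matrix
  \<open>S\<close> of this basis intertwines the two.\<close>

lemma compatible_in_orbit:
  fixes M :: "real^('n::finite + 'n)^('n + 'n)"
  assumes M: "M \<in> Sp" "M ** M = - mat 1"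
    and pos: "\<And>v. v \<noteq> 0 \<Longrightarrow> omega_std v (M *v v) > 0"
  shows "\<exists>S\<in>Sp. M = S ** - J_std ** matrix_inv S"
proof -
  obtain e :: "'n \<Rightarrow> real^('n + 'n)" where e: "\<And>a b. omega_std (e a) (e b) = 0"
      "\<And>a b. omega_std (e a) (M *v e b) = (if a = b then 1 else 0)"
    using isotropic_orthonormal_family[of M UNIV] M pos by auto
  define S :: "real^('n + 'n)^('n + 'n)"
    where "S = (\<chi> i k. (case k of Inl a \<Rightarrow> e a | Inr a \<Rightarrow> M *v e a) $ i)"
  have S: "column (Inl a) S = e a" "column (Inr a) S = M *v e a" for a
    by (simp_all add: S_def column_def vec_eq_iff)
  \<comment> \<open>The lower left block follows from antisymmetry, the lower right one from
    invariance of the form under \<open>M\<close>.\<close>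
  have "(transpose S ** J_std ** S) $ i $ k = J_std $ i $ k" for i k
    unfolding transpose_J_std_mult_nth
    using omega_std_commute[of "M *v e a" "e b" for a b]
    by (cases i; cases k) (simp_all add: S e J_std_nth omega_std_Sp[OF M(1)])
  then have SSp: "S \<in> Sp"
    by (simp add: Sp_def vec_eq_iff)
  have col: "column k (M ** S) = M *v column k S" for k
    by (simp add: column_def matrix_matrix_mult_def matrix_vector_mult_def)
  have "(S ** - J_std) $ i $ k = (M ** S) $ i $ k" for i k
  proof -
    have "(M ** S) $ i $ k = (M *v column k S) $ i"
      using col[of k] by (simp add: column_def vec_eq_iff)
    moreover have "S $ i $ Inl a = e a $ i" "S $ i $ Inr a = (M *v e a) $ i" for a
      by (simp_all add: S_def)
    moreover have "M *v (M *v v) = - v" for v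
      by (simp add: matrix_vector_mul_assoc M(2) matrix_vector_mult_uminus_left)
    ultimately show ?thesis
      by (cases k) (simp_all add: matrix_matrix_mult_def[of S] UNIV_sum_split J_std_nth S
        if_distrib if_distribR sum_negf cong: if_cong)
  qed
  then have "S ** - J_std = M ** S"
    by (simp add: vec_eq_iff)
  then have "S ** - J_std ** matrix_inv S = M"
    by (simp add: Sp_matrix_inv_mult[OF SSp] flip: matrix_mul_assoc)
  then show ?thesis using SSp by blast
qed

section \<open>Compatibility of orbit elements\<close>

lemma orbit_compatible:
  fixes S :: "real^('n::finite + 'n)^('n + 'n)"
  assumes S: "S \<in> Sp"
  defines "M \<equiv> S ** - J_std ** matrix_inv S"
  shows "M \<in> Sp" "M ** M = - mat 1" "v \<noteq> 0 \<Longrightarrow> omega_std v (M *v v) > 0"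
proof -
  have M: "M = - (S ** transpose S ** J_std)"
    by (simp add: M_def conjugate_uminus_J_std[OF S])
  show "M \<in> Sp"
    unfolding M by (intro uminus_in_Sp Sp_mult S Sp_transpose J_std_in_Sp)
  have "M ** M = S ** (- J_std ** (matrix_inv S ** S) ** - J_std) ** matrix_inv S"
    by (simp add: M_def matrix_mul_assoc)
  also have "\<dots> = - mat 1"
    by (simp add: Sp_matrix_inv_mult[OF S]
        matrix_mult_minus_left matrix_mult_minus_right J_std_square)
  finally show "M ** M = - mat 1" .
  assume "v \<noteq> 0"
  \<comment> \<open>Injectivity makes the squared norm strictly positive away from zero.\<close>
  moreover have "invertible (transpose S ** J_std)"
    by (intro Sp_invertible Sp_mult Sp_transpose S J_std_in_Sp)
  ultimately have "transpose S ** J_std *v v \<noteq> 0"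
    by (metis invertible_left_inverse matrix_left_invertible_ker)
  then show "omega_std v (M *v v) > 0"
    unfolding M omega_std_conjugate by (simp add: matrix_vector_mul_assoc)
qed

text \<open>Multiplying the group equation on the right by \<open>M\<close> and using
  \<open>M ** M = - mat 1\<close> makes it linear in \<open>M\<close>.\<close>

lemma Sp_complex_structure_in_sp_algebra:
  assumes M: "M \<in> Sp" "M ** M = - mat 1"
  shows "M \<in> sp_algebra"
proof -
  have "transpose M ** J_std ** M ** M = J_std ** M"
    using M by (simp add: Sp_def)
  then have "- (transpose M ** J_std) = J_std ** M"
    by (simp add: M(2) matrix_mult_minus_right flip: matrix_mul_assoc)
  then show ?thesis by (simp add: sp_algebra_def flip: \<open>- _ = _\<close>)
qed

text \<open>Passes from linear maps to matrices, so that the comparison with the orbit takes place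
  among matrices only.\<close>

lemma matrix_image_compatible:
  "matrix ` (compatible_complex_structures :: (real^('n::finite + 'n) \<Rightarrow> real^('n + 'n)) set)
    = {M \<in> Sp. M ** M = - mat 1 \<and> (\<forall>v. v \<noteq> 0 \<longrightarrow> omega_std v (M *v v) > 0)}"
  (is "_ = ?R")
proof (intro equalityI subsetI)
  fix M :: "real^('n + 'n)^('n + 'n)" assume "M \<in> matrix ` compatible_complex_structures"
  then obtain j where j: "M = matrix j" "linear j" "\<And>v. j (j v) = - v" "M \<in> Sp"
      "\<And>v. v \<noteq> 0 \<Longrightarrow> omega_std v (j v) > 0"
    by (auto simp: compatible_complex_structures_def complex_structure_def positive_definite_def)
  then have jM: "j v = M *v v" for v by (simp add: matrix_works)
  have "M ** M *v v = - mat 1 *v v" for v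
    using j(3)[of v] by (simp add: jM matrix_vector_mul_assoc matrix_vector_mult_uminus_left)
  then have "M ** M = - mat 1"
    unfolding matrix_eq by blast
  moreover have "omega_std v (M *v v) > 0" if "v \<noteq> 0" for v
    using j(5)[OF that] by (simp only: jM)
  ultimately show "M \<in> ?R" using j(4) by blast
next
  fix M :: "real^('n + 'n)^('n + 'n)" assume M: "M \<in> ?R"
  then have "M ** M = - mat 1"
    by simp
  then have "M *v (M *v v) = - v" for v
    by (simp only: matrix_vector_mul_assoc matrix_vector_mult_uminus_left matrix_vector_mul_lid)
  with M have "((*v) M) \<in> compatible_complex_structures"
    by (simp add: compatible_complex_structures_def complex_structure_def positive_definite_def)
  then show "M \<in> matrix ` compatible_complex_structures"
    by (metis image_eqI matrix_of_matrix_vector_mul)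
qed

theorem proposition5p2:
  shows "j_Sp (mat 1) = - (J_std :: real^('n::finite + 'n)^('n + 'n))
    \<and> adjoint_orbit (j_Sp (mat 1)) \<subseteq> (sp_algebra :: (real^('n + 'n)^('n + 'n)) set)
    \<and> adjoint_orbit (j_Sp (mat 1))
        = matrix ` (compatible_complex_structures :: (real^('n + 'n) \<Rightarrow> real^('n + 'n)) set)"
proof -
  have j: "j_Sp (mat 1) = - (J_std :: real^('n + 'n)^('n + 'n))"
    by (simp add: j_Sp_def transpose_mat)
  have eq: "adjoint_orbit (- J_std)
      = matrix ` (compatible_complex_structures :: (real^('n + 'n) \<Rightarrow> real^('n + 'n)) set)"
    (is "?O = ?C")
  proof (intro equalityI subsetI)
    fix M assume "M \<in> ?O"
    then show "M \<in> ?C"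
      by (auto simp: matrix_image_compatible adjoint_orbit_def intro: orbit_compatible)
  next
    fix M assume "M \<in> ?C"
    then have "\<exists>S\<in>Sp. M = S ** - J_std ** matrix_inv S"
      by (intro compatible_in_orbit) (simp_all add: matrix_image_compatible)
    then show "M \<in> ?O"
      by (auto simp: adjoint_orbit_def)
  qed
  \<comment> \<open>The identification of the orbit supplies the two facts needed here: its elements
    are symplectic and square to \<open>- mat 1\<close>.\<close>
  have "M \<in> sp_algebra"
    if "M \<in> adjoint_orbit (- J_std)" for M :: "real^('n + 'n)^('n + 'n)"
    using that by (intro Sp_complex_structure_in_sp_algebra) (simp_all add: eq matrix_image_compatible)
  with j eq show ?thesis by (simp add: subset_iff)
qed

end
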